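(* The subgroup of $\mathrm{Hom}_{grp}(\mathbb C^*,\mathbb C^* )\times\mathbb C$ whose unipotent component is $\mathbb Z\subset\mathbb C$ and whose semi-simple component is generated by $\gamma_1$ and $\gamma_2$, i.e. the subgroup $\langle\gamma_1,\gamma_2\rangle\times\mathbb Z$, is Zariski-dense in the local Galois group $$G^{(0)}=\{(\gamma,\lambda)\in\mathrm{Hom}_{grp}(\mathbb C^*,\mathbb C^* )\times\mathbb C\;:\;\gamma(q)=1\}\simeq\mathrm{Hom}_{grp}(\mathbb C^*/q^{\mathbb Z},\mathbb C^* )\times\mathbb C .$$
   Context: Fix $q\in\mathbb C$ with $|q|>1$ and $\tau\in\mathbb C$ with $\mathrm{Im}(\tau)>0$ and $q=e^{-2i\pi\tau}$. For $y\in\mathbb R$ put $q^y=e^{-2i\pi\tau y}$; every $z\in\mathbb C^*$ is uniquely $z=uq^y$ with $|u|=1$, $y\in\mathbb R$. The group homomorphisms $\gamma_1,\gamma_2:\mathbb C^*\to\mathbb C^*$ are $$\gamma_1(uq^y)=u,\qquad \gamma_2(uq^y)=e^{2i\pi y};$$ both send $q$ to $1$. $G^{(0)}$ is the Galois group (at any base point $z_0\in\mathbb C^*$) of the local category of fuchsian $q$-difference systems. Equivalently, it is the group of tensor automorphisms of the fibre functor $(\mathbb C^n,A)\mapsto\mathbb C^n$, $F\mapsto F(z_0)$ on the category $\mathcal P^{(0)}$ with objects $(\mathbb C^n,A)$, $A\in GL_n(\mathbb C)$, and morphisms $(\mathbb C^n,A)\to(\mathbb C^p,B)$ the matrices $F(z)$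 with entries germs of meromorphic functions at $0$ (automatically Laurent polynomials) such that $F(qz)A=BF(z)$. An element $(\gamma,\lambda)$ acts on $(\mathbb C^n,A)$ by $\gamma(A_s)A_u^\lambda$, where $A=A_sA_u$ is the multiplicative Jordan decomposition, $\gamma$ acts on the eigenvalues of $A_s$, and $A_u^\lambda=\sum_k\binom{\lambda}{k}(A_u-I_n)^k$. $G^{(0)}$ is a proalgebraic group with semi-simple component $\mathrm{Hom}_{grp}(\mathbb C^*/q^{\mathbb Z},\mathbb C^* )$ (the complex points of $\mathrm{Spec}\,\mathbb C[\mathbb C^*/q^{\mathbb Z}]$, spectrum of the group algebra) and unipotent component $\mathbb C=\mathbf G_a(\mathbb C)$; the Zariski topology is that of this proalgebraic structure. *)

theory Defs
  imports
    "HOL-Analysis.Analysis"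
    "HOL-Computational_Algebra.Polynomial"
    "HOL-Algebra.Generated_Groups"
begin

definition Cstar :: "complex monoid" where
  "Cstar = \<lparr>carrier = - {0}, monoid.mult = (*), one = 1\<rparr>"

definition Gadd :: "complex monoid" where
  "Gadd = \<lparr>carrier = UNIV, monoid.mult = (+), one = 0\<rparr>"

text \<open>The group of homomorphisms into \<open>H\<close> under the pointwise product. Homomorphisms are required to be
  extensional, so that two of them are equal exactly when they agree on \<open>carrier G\<close>.\<close>

definition hom_group :: "('a, 'c) monoid_scheme \<Rightarrow> ('b, 'd) monoid_scheme \<Rightarrow> ('a \<Rightarrow> 'b) monoid" where
  "hom_group G H =
     \<lparr>carrier = hom G H \<inter> extensional (carrier G),
      monoid.mult = (\<lambda>f g. \<lambda>x\<in>carrier G. f x \<otimes>\<^bsub>H\<^esub> g x),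
      one = (\<lambda>x\<in>carrier G. \<one>\<^bsub>H\<^esub>)\<rparr>"

definition q_powers :: "complex \<Rightarrow> complex set" where
  "q_powers q = generate Cstar {q}"

definition Cstar_mod_q :: "complex \<Rightarrow> complex set monoid" where
  "Cstar_mod_q q = Cstar Mod q_powers q"

text \<open>The group \<open>G\<^sup>(\<^sup>0\<^sup>)\<close>, presented by its points: \<open>(\<gamma>, l)\<close> stands for the tensor automorphism acting on the object
  \<open>(C\<^sup>n, A)\<close> by \<open>\<gamma>(A\<^sub>s) A\<^sub>u\<^sup>l\<close>, with \<open>A = A\<^sub>s A\<^sub>u\<close> the multiplicative Jordan decomposition.\<close>

definition local_galois_group :: "complex \<Rightarrow> ((complex \<Rightarrow> complex) \<times> complex) monoid" where
  "local_galois_group q =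
     (hom_group Cstar Cstar \<times>\<times> Gadd)
       \<lparr>carrier := {(\<gamma>, l) \<in> carrier (hom_group Cstar Cstar \<times>\<times> Gadd). \<gamma> q = 1}\<rparr>"

text \<open>The canonical map to \<open>Hom(C\<^sup>*/q\<^sup>Z, C\<^sup>*) \<times> C\<close>: a homomorphism \<open>\<gamma>\<close> killing \<open>q\<close> takes a single value on
  each coset of \<open>q\<^sup>Z\<close>.\<close>

definition descend ::
    "complex \<Rightarrow> (complex \<Rightarrow> complex) \<times> complex \<Rightarrow> (complex set \<Rightarrow> complex) \<times> complex" where
  "descend q = (\<lambda>(\<gamma>, l). (\<lambda>c\<in>carrier (Cstar_mod_q q). the_elem (\<gamma> ` c), l))"

text \<open>For an abelian group \<open>M\<close>, the proalgebraic group with points \<open>Hom(M, C\<^sup>*) \<times> C\<close> is the spectrum of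
  \<open>C[M] \<otimes> C[t] = C[t][M]\<close>, whose elements are the finitely supported families \<open>f\<close> of polynomials indexed
  by \<open>M\<close>. The element \<open>\<Sum>\<^sub>c f c \<cdot> [c]\<close> takes the value \<open>\<Sum>\<^sub>c (f c)(l) \<cdot> \<phi> c\<close> at the point \<open>(\<phi>, l)\<close>.\<close>

definition coordinate_ring :: "('a, 'c) monoid_scheme \<Rightarrow> ('a \<Rightarrow> complex poly) set" where
  "coordinate_ring M = {f. finite {c. f c \<noteq> 0} \<and> {c. f c \<noteq> 0} \<subseteq> carrier M}"

definition eval_at :: "('a \<Rightarrow> complex poly) \<Rightarrow> ('a \<Rightarrow> complex) \<times> complex \<Rightarrow> complex" where
  "eval_at f = (\<lambda>(\<phi>, l). \<Sum>c | f c \<noteq> 0. poly (f c) l * \<phi> c)"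

definition zero_locus ::
    "('a, 'c) monoid_scheme \<Rightarrow> ('a \<Rightarrow> complex poly) set \<Rightarrow> (('a \<Rightarrow> complex) \<times> complex) set" where
  "zero_locus M F = {p \<in> carrier (hom_group M Cstar \<times>\<times> Gadd). \<forall>f\<in>F. eval_at f p = 0}"

definition zariski_topology :: "('a, 'c) monoid_scheme \<Rightarrow> (('a \<Rightarrow> complex) \<times> complex) topology" where
  "zariski_topology M =
     topology (\<lambda>U. \<exists>F \<subseteq> coordinate_ring M.
                     U = carrier (hom_group M Cstar \<times>\<times> Gadd) - zero_locus M F)"

definition galois_zariski_topology :: "complex \<Rightarrow> ((complex \<Rightarrow> complex) \<times> complex) topology" where
  "galois_zariski_topology q =
     pullback_topology (carrier (local_galois_group q)) (descend q) (zariski_topology (Cstar_mod_q q))"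

lemma eval_at_prod:
  assumes M: "monoid M" and f: "f \<in> coordinate_ring M" and g: "g \<in> coordinate_ring M"
  obtains h where "h \<in> coordinate_ring M"
    "\<And>p. p \<in> carrier (hom_group M Cstar \<times>\<times> Gadd) \<Longrightarrow> eval_at h p = eval_at f p * eval_at g p"
proof -
  interpret monoid M by (rule M)
  define S where "S = {c. f c \<noteq> 0} \<times> {c. g c \<noteq> 0}"
  define m where "m = (\<lambda>(c, d). c \<otimes>\<^bsub>M\<^esub> d)"
  define h where "h = (\<lambda>e. \<Sum>(c, d) \<in> {x \<in> S. m x = e}. f c * g d)"
  have fin: "finite S" using f g by (simp add: S_def coordinate_ring_def)
  have S_M: "S \<subseteq> carrier M \<times> carrier M" using f g by (auto simp: S_def coordinate_ring_def)
  have supp: "{e. h e \<noteq> 0} \<subseteq> m ` S"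
  proof (rule subsetI, rule ccontr)
    fix e assume e: "e \<in> {e. h e \<noteq> 0}" "e \<notin> m ` S"
    from e(2) have "{x \<in> S. m x = e} = {}" by blast
    then have "h e = 0" unfolding h_def by (simp only: sum.empty)
    then show False using e(1) by blast
  qed
  have mS: "m ` S \<subseteq> carrier M" using S_M by (auto simp: m_def)
  have "h \<in> coordinate_ring M"
    unfolding coordinate_ring_def using finite_subset[OF supp] supp mS fin by blast
  moreover have "eval_at h p = eval_at f p * eval_at g p"
    if p: "p \<in> carrier (hom_group M Cstar \<times>\<times> Gadd)" for p
  proof -
    obtain \<phi> l where pe: "p = (\<phi>, l)" by (cases p)
    have hom: "\<phi> (c \<otimes>\<^bsub>M\<^esub> d) = \<phi> c * \<phi> d" if "c \<in> carrier M" "d \<in> carrier M" for c d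
      using p that by (auto simp: pe hom_group_def hom_def Cstar_def)
    have "eval_at h p = (\<Sum>e\<in>m ` S. poly (h e) l * \<phi> e)"
      unfolding eval_at_def pe prod.case
      by (rule sum.mono_neutral_left) (use supp fin in auto)
    also have "\<dots> = (\<Sum>e\<in>m ` S. \<Sum>x\<in>{x \<in> S. m x = e}. poly (f (fst x)) l * poly (g (snd x)) l * \<phi> (m x))"
      by (intro sum.cong refl)
         (auto simp: h_def poly_sum sum_distrib_right case_prod_beta intro!: sum.cong)
    also have "\<dots> = (\<Sum>x\<in>S. poly (f (fst x)) l * poly (g (snd x)) l * \<phi> (m x))"
      by (rule sum.image_gen[OF fin, symmetric])
    also have "\<dots> = (\<Sum>(c, d)\<in>S. (poly (f c) l * \<phi> c) * (poly (g d) l * \<phi> d))"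
      by (rule sum.cong) (use S_M in \<open>auto simp: m_def hom\<close>)
    also have "\<dots> = eval_at f p * eval_at g p"
      by (simp add: S_def eval_at_def pe sum_product sum.cartesian_product)
    finally show ?thesis .
  qed
  ultimately show ?thesis using that by blast
qed

lemma istopology_zariski:
  assumes M: "monoid M"
  shows "istopology (\<lambda>U. \<exists>F \<subseteq> coordinate_ring M.
                          U = carrier (hom_group M Cstar \<times>\<times> Gadd) - zero_locus M F)"
    (is "istopology ?P")
  unfolding istopology_def
proof (intro conjI allI impI)
  fix U V assume "?P U" "?P V"
  then obtain F G where F: "F \<subseteq> coordinate_ring M" "U = carrier (hom_group M Cstar \<times>\<times> Gadd) - zero_locus M F"
    and G: "G \<subseteq> coordinate_ring M" "V = carrier (hom_group M Cstar \<times>\<times> Gadd) - zero_locus M G" by blast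
  define H where "H = {h \<in> coordinate_ring M. \<exists>f\<in>F. \<exists>g\<in>G.
    \<forall>p\<in>carrier (hom_group M Cstar \<times>\<times> Gadd). eval_at h p = eval_at f p * eval_at g p}"
  have "\<exists>h\<in>H. \<forall>p\<in>carrier (hom_group M Cstar \<times>\<times> Gadd). eval_at h p = eval_at f p * eval_at g p"
    if "f \<in> F" "g \<in> G" for f g
  proof -
    obtain h where "h \<in> coordinate_ring M"
      "\<And>p. p \<in> carrier (hom_group M Cstar \<times>\<times> Gadd) \<Longrightarrow> eval_at h p = eval_at f p * eval_at g p"
      using eval_at_prod[OF M, of f g] F(1) G(1) \<open>f \<in> F\<close> \<open>g \<in> G\<close> by blast
    then show ?thesis using that by (intro bexI[of _ h]) (auto simp: H_def)
  qed
  then have 1: "p \<in> U \<inter> V \<Longrightarrow> p \<in> carrier (hom_group M Cstar \<times>\<times> Gadd) - zero_locus M H" for p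
    unfolding F(2) G(2) zero_locus_def by (auto; metis mult_eq_0_iff)
  have 2: "p \<in> carrier (hom_group M Cstar \<times>\<times> Gadd) - zero_locus M H \<Longrightarrow> p \<in> U \<inter> V" for p
    unfolding F(2) G(2) zero_locus_def H_def by fastforce
  have "U \<inter> V = carrier (hom_group M Cstar \<times>\<times> Gadd) - zero_locus M H" using 1 2 by blast
  moreover have "H \<subseteq> coordinate_ring M" by (auto simp: H_def)
  ultimately show "?P (U \<inter> V)" by blast
next
  fix K assume "\<forall>U\<in>K. ?P U"
  then obtain F where F: "\<And>U. U \<in> K \<Longrightarrow> F U \<subseteq> coordinate_ring M"
    "\<And>U. U \<in> K \<Longrightarrow> U = carrier (hom_group M Cstar \<times>\<times> Gadd) - zero_locus M (F U)" by metis
  have "\<Union>K = (\<Union>U\<in>K. carrier (hom_group M Cstar \<times>\<times> Gadd) - zero_locus M (F U))"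
    using F(2) by blast
  also have "\<dots> = carrier (hom_group M Cstar \<times>\<times> Gadd) - zero_locus M (\<Union>(F ` K))"
    by (auto simp: zero_locus_def)
  finally show "?P (\<Union>K)" using F(1) by (intro exI[of _ "\<Union>(F ` K)"]) auto
qed

lemma openin_zariski:
  assumes "monoid M"
  shows "openin (zariski_topology M) U \<longleftrightarrow>
    (\<exists>F \<subseteq> coordinate_ring M. U = carrier (hom_group M Cstar \<times>\<times> Gadd) - zero_locus M F)"
  unfolding zariski_topology_def topology_inverse'[OF istopology_zariski[OF assms]] by (rule refl)

lemma topspace_zariski:
  assumes "monoid M"
  shows "topspace (zariski_topology M) = carrier (hom_group M Cstar \<times>\<times> Gadd)"
proof -
  define u where "u = (\<lambda>c. if c = \<one>\<^bsub>M\<^esub> then 1 else (0::complex poly))"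
  have supp: "{c. u c \<noteq> 0} = {\<one>\<^bsub>M\<^esub>}" by (auto simp: u_def)
  have "\<one>\<^bsub>M\<^esub> \<in> carrier M" using assms by (simp add: monoid.one_closed)
  then have u: "u \<in> coordinate_ring M" and "zero_locus M {u} = {}"
    by (auto simp: coordinate_ring_def supp zero_locus_def eval_at_def hom_group_def hom_def Cstar_def,
        auto simp: u_def)
  then have "openin (zariski_topology M) (carrier (hom_group M Cstar \<times>\<times> Gadd))"
    unfolding openin_zariski[OF assms] by (intro exI[of _ "{u}"]) auto
  moreover have "U \<subseteq> carrier (hom_group M Cstar \<times>\<times> Gadd)" if "openin (zariski_topology M) U" for U
    using that unfolding openin_zariski[OF assms] by blast
  ultimately show ?thesis
    by (meson openin_subset openin_topspace subset_antisym)
qed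

lemma closedin_zariski:
  assumes "monoid M"
  shows "closedin (zariski_topology M) C \<longleftrightarrow> (\<exists>F \<subseteq> coordinate_ring M. C = zero_locus M F)"
proof -
  have "zero_locus M F \<subseteq> carrier (hom_group M Cstar \<times>\<times> Gadd)" for F by (auto simp: zero_locus_def)
  then have *: "C \<subseteq> carrier (hom_group M Cstar \<times>\<times> Gadd) \<and>
      carrier (hom_group M Cstar \<times>\<times> Gadd) - C = carrier (hom_group M Cstar \<times>\<times> Gadd) - zero_locus M F
      \<longleftrightarrow> C = zero_locus M F" for F by blast
  have "closedin (zariski_topology M) C \<longleftrightarrow> (\<exists>F \<subseteq> coordinate_ring M.
      C \<subseteq> carrier (hom_group M Cstar \<times>\<times> Gadd) \<and>
      carrier (hom_group M Cstar \<times>\<times> Gadd) - C = carrier (hom_group M Cstar \<times>\<times> Gadd) - zero_locus M F)"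
    unfolding closedin_def topspace_zariski[OF assms] openin_zariski[OF assms] by blast
  then show ?thesis by (simp only: *)
qed

text \<open>\<open>q_pow \<tau> y\<close> is \<open>q\<^sup>y\<close>, for the choice of \<open>\<tau>\<close> with \<open>q = e\<^sup>-\<^sup>2\<^sup>i\<^sup>\<pi>\<^sup>\<tau>\<close>.\<close>

definition q_pow :: "complex \<Rightarrow> real \<Rightarrow> complex" where
  "q_pow \<tau> y = exp (- 2 * \<i> * of_real pi * \<tau> * of_real y)"

definition gamma1 :: "complex \<Rightarrow> complex \<Rightarrow> complex" where
  "gamma1 \<tau> = (\<lambda>z\<in>carrier Cstar. THE u. norm u = 1 \<and> (\<exists>y. z = u * q_pow \<tau> y))"

definition gamma2 :: "complex \<Rightarrow> complex \<Rightarrow> complex" where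
  "gamma2 \<tau> = (\<lambda>z\<in>carrier Cstar.
     exp (2 * \<i> * of_real pi * of_real (THE y. \<exists>u. norm u = 1 \<and> z = u * q_pow \<tau> y)))"

lemma norm_q_pow: "norm (q_pow \<tau> y) = exp (2 * pi * Im \<tau> * y)"
  by (simp add: q_pow_def)

lemma polar_unique:
  assumes "Im \<tau> > 0" "norm u = 1" "norm v = 1" "u * q_pow \<tau> y = v * q_pow \<tau> x"
  shows "u = v" "y = x"
proof -
  have "norm (u * q_pow \<tau> y) = norm (v * q_pow \<tau> x)" using assms(4) by simp
  then show "y = x" using assms(1-3) by (simp add: norm_mult norm_q_pow)
  then show "u = v" using assms(4) by (simp add: q_pow_def)
qed

lemma polar_exists:
  assumes "Im \<tau> > 0" "z \<noteq> 0"
  obtains u y where "norm u = 1" "z = u * q_pow \<tau> y"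
proof
  define y where "y = ln (norm z) / (2 * pi * Im \<tau>)"
  have "norm (q_pow \<tau> y) = norm z" using assms by (simp add: norm_q_pow y_def)
  then show "norm (z / q_pow \<tau> y) = 1" using assms by (simp add: norm_divide)
  show "z = z / q_pow \<tau> y * q_pow \<tau> y" by (simp add: q_pow_def)
qed

lemma gamma_eq:
  assumes "Im \<tau> > 0" "norm u = 1"
  shows "gamma1 \<tau> (u * q_pow \<tau> y) = u"
    and "gamma2 \<tau> (u * q_pow \<tau> y) = exp (2 * \<i> * of_real pi * of_real y)"
proof -
  have ne: "u * q_pow \<tau> y \<in> carrier Cstar" using assms by (auto simp: Cstar_def q_pow_def)
  show "gamma1 \<tau> (u * q_pow \<tau> y) = u"
    unfolding gamma1_def restrict_apply'[OF ne]
    by (rule the_equality) (use assms polar_unique[OF assms(1)] in blast)+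
  have "(THE x. \<exists>v. norm v = 1 \<and> u * q_pow \<tau> y = v * q_pow \<tau> x) = y"
    by (rule the_equality) (use assms polar_unique[OF assms(1)] in metis)+
  then show "gamma2 \<tau> (u * q_pow \<tau> y) = exp (2 * \<i> * of_real pi * of_real y)"
    unfolding gamma2_def restrict_apply'[OF ne] by simp
qed

definition gamma_Z_subgroup :: "complex \<Rightarrow> ((complex \<Rightarrow> complex) \<times> complex) set" where
  "gamma_Z_subgroup \<tau> = generate (hom_group Cstar Cstar) {gamma1 \<tau>, gamma2 \<tau>} \<times> \<int>"

end

theory Submission
  imports Defs
begin

text \<open>Write \<open>M = C\<^sup>*/q\<^sup>Z\<close>. A regular function on \<open>Hom(M, C\<^sup>*) \<times> C\<close> is a finite sum \<open>\<Sum>\<^sub>c f\<^sub>c(l) \<phi>(c)\<close>, so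
  density means that such a function vanishing on \<open>\<langle>\<gamma>\<^sub>1, \<gamma>\<^sub>2\<rangle> \<times> Z\<close> has all its coefficients \<open>f\<^sub>c\<close> equal
  to \<open>0\<close>. The values of \<open>\<gamma>\<^sub>1\<^sup>a \<gamma>\<^sub>2\<^sup>b\<close> at the finitely many classes \<open>c\<close> involved are the monomials
  \<open>x\<^sub>c\<^sup>a y\<^sub>c\<^sup>b\<close> with \<open>x\<^sub>c = \<gamma>\<^sub>1(c)\<close> and \<open>y\<^sub>c = \<gamma>\<^sub>2(c)\<close>. The point is that \<open>\<gamma>\<^sub>1\<close> and \<open>\<gamma>\<^sub>2\<close> together
  separate the classes (\<open>gamma_separate\<close>): for \<open>z = u q\<^sup>y\<close> the first one determines \<open>u\<close>, and the
  second one determines \<open>y\<close> up to an integer, which is exactly the ambiguity of a representative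
  modulo \<open>q\<^sup>Z\<close>. The pairs \<open>(x\<^sub>c, y\<^sub>c)\<close> are therefore distinct, and the functions \<open>(a, b) \<mapsto> x\<^sub>c\<^sup>a y\<^sub>c\<^sup>b\<close>
  are linearly independent (\<open>independent_monomials\<close>). Hence \<open>f\<^sub>c(n) = 0\<close> for every integer \<open>n\<close>, and a
  polynomial with infinitely many roots is \<open>0\<close> (\<open>vanishing_on_powers_imp_0\<close>). The test points
  are taken with \<open>a\<close>, \<open>b\<close>, \<open>n\<close> nonnegative, so that polynomials can be substituted for the powers of
  \<open>x\<^sub>c\<close> and \<open>y\<^sub>c\<close>.

  The other two claims are formal. The isomorphism is the universal property of the quotient: homomorphisms
  on \<open>G\<close> trivial on a normal subgroup \<open>N\<close> are the homomorphisms on \<open>G/N\<close>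
  (\<open>annihilator_iso_hom_quotient\<close>). The set \<open>\<langle>\<gamma>\<^sub>1, \<gamma>\<^sub>2\<rangle> \<times> Z\<close> is a subgroup of the local Galois group
  because \<open>\<gamma>\<^sub>1\<close> and \<open>\<gamma>\<^sub>2\<close> send \<open>q\<close> to \<open>1\<close>.\<close>

section \<open>Groups of homomorphisms and quotients\<close>

lemma comm_group_Cstar: "comm_group Cstar"
proof (rule comm_groupI)
  fix x assume "x \<in> carrier Cstar"
  then show "\<exists>y\<in>carrier Cstar. y \<otimes>\<^bsub>Cstar\<^esub> x = \<one>\<^bsub>Cstar\<^esub>"
    by (intro bexI[of _ "inverse x"]) (auto simp: Cstar_def)
qed (auto simp: Cstar_def)

lemma group_Gadd: "group Gadd"
proof (rule groupI)
  fix x assume "x \<in> carrier Gadd"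
  then show "\<exists>y\<in>carrier Gadd. y \<otimes>\<^bsub>Gadd\<^esub> x = \<one>\<^bsub>Gadd\<^esub>"
    by (intro bexI[of _ "- x"]) (auto simp: Gadd_def)
qed (auto simp: Gadd_def)

lemma subgroup_Ints: "subgroup \<int> Gadd"
proof (rule group.subgroupI[OF group_Gadd])
  fix a :: complex assume a: "a \<in> \<int>"
  have "inv\<^bsub>Gadd\<^esub> a = - a"
    by (rule group.inv_equality[OF group_Gadd]) (auto simp: Gadd_def)
  with a show "inv\<^bsub>Gadd\<^esub> a \<in> \<int>" by simp
qed (auto simp: Gadd_def)

text \<open>Commutativity of the target is what makes pointwise products and inverses of homomorphisms
  homomorphisms again.\<close>

lemma group_hom_group:
  assumes G: "group G" and H: "comm_group H"
  shows "group (hom_group G H)"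
proof -
  interpret G: group G by (rule G)
  interpret H: comm_group H by (rule H)
  show ?thesis
  proof (rule groupI)
    fix f g assume "f \<in> carrier (hom_group G H)" "g \<in> carrier (hom_group G H)"
    then show "f \<otimes>\<^bsub>hom_group G H\<^esub> g \<in> carrier (hom_group G H)"
      by (auto simp: hom_group_def hom_def Pi_iff H.m_ac)
  next
    show "\<one>\<^bsub>hom_group G H\<^esub> \<in> carrier (hom_group G H)"
      by (auto simp: hom_group_def hom_def)
  next
    fix f g h
    assume "f \<in> carrier (hom_group G H)" "g \<in> carrier (hom_group G H)" "h \<in> carrier (hom_group G H)"
    then show "f \<otimes>\<^bsub>hom_group G H\<^esub> g \<otimes>\<^bsub>hom_group G H\<^esub> h
        = f \<otimes>\<^bsub>hom_group G H\<^esub> (g \<otimes>\<^bsub>hom_group G H\<^esub> h)"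
      by (auto simp: hom_group_def hom_def Pi_iff H.m_assoc intro!: restrict_ext)
  next
    fix f assume "f \<in> carrier (hom_group G H)"
    then show "\<one>\<^bsub>hom_group G H\<^esub> \<otimes>\<^bsub>hom_group G H\<^esub> f = f"
      by (auto simp: hom_group_def hom_def Pi_iff extensional_def fun_eq_iff)
  next
    fix f assume f: "f \<in> carrier (hom_group G H)"
    define g where "g = (\<lambda>x\<in>carrier G. inv\<^bsub>H\<^esub> f x)"
    have "g \<in> carrier (hom_group G H)"
      using f by (auto simp: g_def hom_group_def hom_def Pi_iff H.inv_mult)
    moreover have "g \<otimes>\<^bsub>hom_group G H\<^esub> f = \<one>\<^bsub>hom_group G H\<^esub>"
      using f by (auto simp: g_def hom_group_def hom_def Pi_iff fun_eq_iff)
    ultimately show "\<exists>g\<in>carrier (hom_group G H). g \<otimes>\<^bsub>hom_group G H\<^esub> f = \<one>\<^bsub>hom_group G H\<^esub>"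
      by blast
  qed
qed

definition annihilator :: "('a, 'c) monoid_scheme \<Rightarrow> ('b, 'd) monoid_scheme \<Rightarrow> 'a set \<Rightarrow> ('a \<Rightarrow> 'b) set" where
  "annihilator G H N = {\<gamma> \<in> carrier (hom_group G H). \<forall>n\<in>N. \<gamma> n = \<one>\<^bsub>H\<^esub>}"

lemma subgroup_annihilator:
  assumes G: "group G" and H: "comm_group H" and N: "N \<subseteq> carrier G"
  shows "subgroup (annihilator G H N) (hom_group G H)"
proof -
  interpret H: comm_group H by (rule H)
  interpret X: group "hom_group G H" by (rule group_hom_group[OF G H])
  show ?thesis
  proof (rule X.subgroupI)
    have "\<one>\<^bsub>hom_group G H\<^esub> \<in> annihilator G H N"
      using X.one_closed N by (auto simp: annihilator_def, auto simp: hom_group_def)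
    then show "annihilator G H N \<noteq> {}" by blast
  next
    fix f assume f: "f \<in> annihilator G H N"
    then have fX: "f \<in> carrier (hom_group G H)" by (simp add: annihilator_def)
    define g where "g = inv\<^bsub>hom_group G H\<^esub> f"
    have g: "g \<in> carrier (hom_group G H)" using fX by (simp add: g_def)
    have "g n = \<one>\<^bsub>H\<^esub>" if n: "n \<in> N" for n
    proof -
      have nG: "n \<in> carrier G" using n N by blast
      have "(g \<otimes>\<^bsub>hom_group G H\<^esub> f) n = \<one>\<^bsub>hom_group G H\<^esub> n" using fX by (simp add: g_def)
      moreover have "f n = \<one>\<^bsub>H\<^esub>" using f n by (simp add: annihilator_def)
      moreover have "g n \<in> carrier H" using g nG by (auto simp: hom_group_def hom_def)
      ultimately show ?thesis using nG by (simp add: hom_group_def)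
    qed
    then show "inv\<^bsub>hom_group G H\<^esub> f \<in> annihilator G H N"
      using g by (simp add: annihilator_def g_def)
  next
    fix f g assume fg: "f \<in> annihilator G H N" "g \<in> annihilator G H N"
    then have "f \<otimes>\<^bsub>hom_group G H\<^esub> g \<in> carrier (hom_group G H)"
      by (intro X.m_closed) (auto simp: annihilator_def)
    then show "f \<otimes>\<^bsub>hom_group G H\<^esub> g \<in> annihilator G H N"
      using fg N by (auto simp: annihilator_def, auto simp: hom_group_def)
  qed (auto simp: annihilator_def)
qed

lemma the_elem_image_coset:
  assumes N: "N \<lhd> G" and H: "group H"
    and \<gamma>: "\<gamma> \<in> annihilator G H N" and x: "x \<in> carrier G"
  shows "the_elem (\<gamma> ` (N #>\<^bsub>G\<^esub> x)) = \<gamma> x"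
proof -
  interpret N: normal N G by (rule N)
  interpret H: group H by (rule H)
  have "\<gamma> (n \<otimes>\<^bsub>G\<^esub> x) = \<gamma> x" if n: "n \<in> N" for n
  proof -
    have "n \<in> carrier G" using n N.subset by blast
    then show ?thesis using \<gamma> n x by (auto simp: annihilator_def hom_group_def hom_def Pi_iff)
  qed
  then have "(\<lambda>n. \<gamma> (n \<otimes>\<^bsub>G\<^esub> x)) ` N = (\<lambda>n. \<gamma> x) ` N" by simp
  moreover have "N \<noteq> {}" using subgroup.one_closed[OF N.subgroup_axioms] by blast
  ultimately have "\<gamma> ` (N #>\<^bsub>G\<^esub> x) = {\<gamma> x}" 
    by (simp add: r_coset_def image_UN image_image image_constant_conv UNION_singleton_eq_range)
  then show ?thesis by simp
qed

text \<open>Surjectivity lifts \<open>\<phi>\<close> to \<open>x \<mapsto> \<phi>(N x)\<close>, and injectivity holds because every \<open>x\<close> lies in a coset.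
  The map is written with \<open>the_elem\<close> of an image, so that its product with the identity
  of \<open>C\<close> is \<open>descend\<close>.\<close>

lemma annihilator_iso_hom_quotient:
  assumes N: "N \<lhd> G" and H: "comm_group H"
  shows "(\<lambda>\<gamma>. \<lambda>c\<in>carrier (G Mod N). the_elem (\<gamma> ` c))
    \<in> iso (hom_group G H \<lparr>carrier := annihilator G H N\<rparr>) (hom_group (G Mod N) H)"
    (is "?d \<in> iso ?A ?B")
proof -
  interpret N: normal N G by (rule N)
  interpret H: comm_group H by (rule H)
  note [simp] = the_elem_image_coset[OF N H.is_group]
  have A: "\<gamma> \<in> annihilator G H N \<Longrightarrow> \<gamma> \<in> hom G H" for \<gamma>
    by (simp add: annihilator_def hom_group_def)
  have into: "?d \<gamma> \<in> carrier ?B" if \<gamma>: "\<gamma> \<in> annihilator G H N" for \<gamma>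
  proof -
    have "?d \<gamma> \<in> hom (G Mod N) H"
      using A[OF \<gamma>] \<gamma>
      by (intro homI) (auto simp: carrier_FactGroup N.rcos_sum hom_def Pi_iff)
    then show ?thesis by (simp add: hom_group_def)
  qed
  have hom: "?d \<in> hom ?A ?B"
  proof (rule homI)
    fix f g assume fg: "f \<in> carrier ?A" "g \<in> carrier ?A"
    have "f \<otimes>\<^bsub>hom_group G H\<^esub> g \<in> annihilator G H N"
      using fg subgroup.m_closed[OF subgroup_annihilator[OF N.is_group H N.subset]] by simp
    then have "?d (f \<otimes>\<^bsub>hom_group G H\<^esub> g) c = (?d f \<otimes>\<^bsub>?B\<^esub> ?d g) c" for c
      using fg by (cases "c \<in> carrier (G Mod N)")
        (auto simp: carrier_FactGroup, auto simp: hom_group_def carrier_FactGroup)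
    then show "?d (f \<otimes>\<^bsub>?A\<^esub> g) = ?d f \<otimes>\<^bsub>?B\<^esub> ?d g" by auto
  qed (use into in auto)
  have inj: "inj_on ?d (carrier ?A)"
  proof (rule inj_onI)
    fix f g assume fg: "f \<in> carrier ?A" "g \<in> carrier ?A" and eq: "?d f = ?d g"
    show "f = g"
    proof (rule extensionalityI[of _ "carrier G"])
      fix x assume x: "x \<in> carrier G"
      then have "N #>\<^bsub>G\<^esub> x \<in> carrier (G Mod N)" by (simp add: carrier_FactGroup)
      then show "f x = g x" using fun_cong[OF eq, of "N #>\<^bsub>G\<^esub> x"] fg x by simp
    qed (use fg in \<open>auto simp: annihilator_def hom_group_def\<close>)
  qed
  have "\<phi> \<in> ?d ` carrier ?A" if \<phi>: "\<phi> \<in> carrier ?B" for \<phi>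
  proof -
    define \<gamma> where "\<gamma> = (\<lambda>x\<in>carrier G. \<phi> (N #>\<^bsub>G\<^esub> x))"
    have \<phi>h: "\<phi> \<in> hom (G Mod N) H" and \<phi>e: "\<phi> \<in> extensional (carrier (G Mod N))"
      using \<phi> by (auto simp: hom_group_def)
    have "\<gamma> \<in> hom G H"
    proof (rule homI)
      fix x y assume "x \<in> carrier G" "y \<in> carrier G"
      then show "\<gamma> (x \<otimes>\<^bsub>G\<^esub> y) = \<gamma> x \<otimes>\<^bsub>H\<^esub> \<gamma> y"
        using hom_mult[OF \<phi>h, of "N #>\<^bsub>G\<^esub> x" "N #>\<^bsub>G\<^esub> y"]
        by (simp add: \<gamma>_def carrier_FactGroup N.rcos_sum)
    qed (use \<phi>h in \<open>auto simp: \<gamma>_def hom_def carrier_FactGroup\<close>)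
    moreover have "\<gamma> n = \<one>\<^bsub>H\<^esub>" if n: "n \<in> N" for n
    proof -
      have "N #>\<^bsub>G\<^esub> n = N" using N.rcos_const[OF N.is_group n] .
      then have "\<gamma> n = \<phi> N" using n N.subset by (auto simp: \<gamma>_def)
      then show ?thesis
        using hom_one[OF \<phi>h N.factorgroup_is_group H.is_group] by simp
    qed
    ultimately have \<gamma>: "\<gamma> \<in> annihilator G H N"
      by (simp add: annihilator_def hom_group_def \<gamma>_def)
    moreover have "?d \<gamma> = \<phi>"
    proof (rule extensionalityI[OF _ \<phi>e])
      fix c assume "c \<in> carrier (G Mod N)"
      then obtain x where "x \<in> carrier G" "c = N #>\<^bsub>G\<^esub> x" by (auto simp: carrier_FactGroup)
      then show "?d \<gamma> c = \<phi> c" using \<gamma> by (simp add: carrier_FactGroup) (simp add: \<gamma>_def)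
    qed simp
    ultimately show ?thesis by auto
  qed
  then show ?thesis using hom inj into unfolding iso_def bij_betw_def by auto
qed

section \<open>A density criterion\<close>

text \<open>By linearity the monomials \<open>x\<^sup>a\<close> may be replaced by any polynomial in \<open>x\<close>. The Lagrange polynomial
  that vanishes at all values of \<open>x\<close> on \<open>S\<close> other than \<open>v\<close> isolates the fibre over \<open>v\<close>.\<close>

lemma sum_over_fibre_eq_0:
  fixes k x :: "'a \<Rightarrow> 'b::field"
  assumes fin: "finite S" and pow: "\<And>a::nat. (\<Sum>c\<in>S. k c * x c ^ a) = 0"
  shows "(\<Sum>c | c \<in> S \<and> x c = v. k c) = 0"
proof -
  have poly0: "(\<Sum>c\<in>S. k c * poly p (x c)) = 0" for p
  proof -
    have "(\<Sum>c\<in>S. k c * poly p (x c)) = (\<Sum>c\<in>S. \<Sum>i\<le>degree p. coeff p i * (k c * x c ^ i))"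
      by (simp add: poly_altdef sum_distrib_left mult_ac)
    also have "\<dots> = (\<Sum>i\<le>degree p. coeff p i * (\<Sum>c\<in>S. k c * x c ^ i))"
      by (subst sum.swap) (simp add: sum_distrib_left)
    finally show ?thesis by (simp add: pow)
  qed
  define p where "p = (\<Prod>w\<in>x ` S - {v}. [:- w, 1:])"
  have root: "poly p (x c) = 0" if "c \<in> S" "x c \<noteq> v" for c
    using that fin by (auto simp: p_def poly_prod)
  have nz: "poly p v \<noteq> 0" using fin by (auto simp: p_def poly_prod)
  have "0 = (\<Sum>c\<in>S. k c * poly p (x c))" by (simp add: poly0)
  also have "\<dots> = (\<Sum>c | c \<in> S \<and> x c = v. k c * poly p (x c))"
    by (rule sum.mono_neutral_right) (use fin root in auto)
  also have "\<dots> = (\<Sum>c | c \<in> S \<and> x c = v. k c) * poly p v"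
    by (simp add: sum_distrib_right)
  finally show ?thesis using nz by simp
qed

text \<open>Isolating the fibre of \<open>x\<close> through \<open>d\<close> for each fixed \<open>b\<close>, and then the fibre of \<open>y\<close> inside it,
  leaves only \<open>d\<close>.\<close>

lemma independent_monomials:
  fixes k x y :: "'a \<Rightarrow> 'b::field"
  assumes fin: "finite S" and inj: "inj_on (\<lambda>c. (x c, y c)) S"
    and pow: "\<And>a b::nat. (\<Sum>c\<in>S. k c * (x c ^ a * y c ^ b)) = 0" and d: "d \<in> S"
  shows "k d = 0"
proof -
  have "(\<Sum>c | c \<in> S \<and> x c = x d. k c * y c ^ b) = 0" for b
  proof (rule sum_over_fibre_eq_0[OF fin])
    fix a
    show "(\<Sum>c\<in>S. k c * y c ^ b * x c ^ a) = 0" using pow[of a b] by (simp add: mult_ac)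
  qed
  then have "(\<Sum>c | c \<in> {c \<in> S. x c = x d} \<and> y c = y d. k c) = 0"
    by (rule sum_over_fibre_eq_0[rotated]) (use fin in simp)
  moreover have "{c. c \<in> {c \<in> S. x c = x d} \<and> y c = y d} = {d}"
    using inj d by (auto dest: inj_onD)
  ultimately show ?thesis by simp
qed

text \<open>The density criterion: if two functions \<open>\<alpha>\<close>, \<open>\<beta>\<close> separate the elements of \<open>M\<close>, a regular function
  is determined by its values at the points \<open>(\<alpha>\<^sup>a \<beta>\<^sup>b, n)\<close>. For fixed \<open>n\<close>, independence of the monomials
  annihilates the numbers \<open>f\<^sub>d(n)\<close>; letting \<open>n\<close> vary annihilates the polynomial \<open>f\<^sub>d\<close>.\<close>

lemma vanishing_on_powers_imp_0:
  assumes f: "f \<in> coordinate_ring M"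
    and sep: "inj_on (\<lambda>c. (\<alpha> c, \<beta> c)) (carrier M)"
    and van: "\<And>a b n. eval_at f (\<lambda>c\<in>carrier M. \<alpha> c ^ a * \<beta> c ^ b, of_nat n) = 0"
  shows "f d = 0"
proof (rule ccontr)
  assume d: "f d \<noteq> 0"
  have fin: "finite {c. f c \<noteq> 0}" and supp: "{c. f c \<noteq> 0} \<subseteq> carrier M"
    using f by (auto simp: coordinate_ring_def)
  have "poly (f d) (of_nat n) = 0" for n
  proof (rule independent_monomials[OF fin inj_on_subset[OF sep supp], where k = "\<lambda>c. poly (f c) (of_nat n)"])
    fix a b
    have "(\<Sum>c | f c \<noteq> 0. poly (f c) (of_nat n) * (\<alpha> c ^ a * \<beta> c ^ b))
        = eval_at f (\<lambda>c\<in>carrier M. \<alpha> c ^ a * \<beta> c ^ b, of_nat n)"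
      unfolding eval_at_def prod.case by (rule sum.cong) (use supp in auto)
    then show "(\<Sum>c | f c \<noteq> 0. poly (f c) (of_nat n) * (\<alpha> c ^ a * \<beta> c ^ b)) = 0"
      by (simp add: van)
  qed (use d in simp)
  then have "range of_nat \<subseteq> {l. poly (f d) l = 0}" by auto
  then have "finite (range (of_nat :: nat \<Rightarrow> complex))"
    using poly_roots_finite[OF d] finite_subset by blast
  then show False using infinite_UNIV_nat finite_imageD[OF _ inj_of_nat] by blast
qed

section \<open>The homomorphisms gamma1 and gamma2\<close>

lemma q_pow_add: "q_pow \<tau> (x + y) = q_pow \<tau> x * q_pow \<tau> y"
  by (simp add: q_pow_def algebra_simps flip: exp_add)

lemma gamma_hom:
  assumes "Im \<tau> > 0"
  shows "gamma1 \<tau> \<in> carrier (hom_group Cstar Cstar)" "gamma2 \<tau> \<in> carrier (hom_group Cstar Cstar)"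
proof -
  have *: "gamma1 \<tau> z \<noteq> 0 \<and> gamma2 \<tau> z \<noteq> 0
      \<and> gamma1 \<tau> (z * w) = gamma1 \<tau> z * gamma1 \<tau> w \<and> gamma2 \<tau> (z * w) = gamma2 \<tau> z * gamma2 \<tau> w"
    if zw: "z \<noteq> 0" "w \<noteq> 0" for z w
  proof -
    obtain u y where z: "norm u = 1" "z = u * q_pow \<tau> y" using polar_exists[OF assms zw(1)] .
    obtain v x where w: "norm v = 1" "w = v * q_pow \<tau> x" using polar_exists[OF assms zw(2)] .
    have zw': "z * w = (u * v) * q_pow \<tau> (y + x)" by (simp add: z w q_pow_add)
    have uv: "norm (u * v) = 1" using z w by (simp add: norm_mult)
    have "u \<noteq> 0" using z by auto
    then show ?thesis
      unfolding zw' gamma_eq[OF assms uv] unfolding z(2) w(2) gamma_eq[OF assms z(1)] gamma_eq[OF assms w(1)]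
      by (simp add: ring_distribs exp_add)
  qed
  show "gamma1 \<tau> \<in> carrier (hom_group Cstar Cstar)"
    using * by (auto simp: hom_group_def hom_def Cstar_def gamma1_def)
  show "gamma2 \<tau> \<in> carrier (hom_group Cstar Cstar)"
    using * by (auto simp: hom_group_def hom_def Cstar_def gamma2_def)
qed

lemma q_pow_of_int_mem: "q_pow \<tau> (of_int k) \<in> q_powers (q_pow \<tau> 1)"
proof -
  interpret comm_group Cstar by (rule comm_group_Cstar)
  have sub: "subgroup (q_powers (q_pow \<tau> 1)) Cstar"
    unfolding q_powers_def by (rule generate_is_subgroup) (auto simp: Cstar_def q_pow_def)
  have mem: "q_pow \<tau> 1 \<in> q_powers (q_pow \<tau> 1)"
    unfolding q_powers_def by (rule generate.incl) simp
  have nat: "q_pow \<tau> (of_nat n) \<in> q_powers (q_pow \<tau> 1)" for n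
  proof (induction n)
    case 0
    then show ?case using subgroup.one_closed[OF sub] by (simp add: q_pow_def Cstar_def)
  next
    case (Suc n)
    then show ?case
      using subgroup.m_closed[OF sub mem Suc] q_pow_add[of \<tau> 1 "of_nat n"]
      by (simp add: Cstar_def)
  qed
  show ?thesis
  proof (cases "k \<ge> 0")
    case True
    then show ?thesis using nat[of "nat k"] by simp
  next
    case False
    have "inv\<^bsub>Cstar\<^esub> q_pow \<tau> (of_nat (nat (- k))) = q_pow \<tau> (of_int k)"
      by (rule inv_equality)
        (use False q_pow_add[of \<tau> "of_int k" "of_nat (nat (- k))"] in
          \<open>auto simp: Cstar_def, auto simp: q_pow_def\<close>)
    then show ?thesis using subgroup.m_inv_closed[OF sub nat[of "nat (- k)"]] by simp
  qed
qed

text \<open>Equality of \<open>\<gamma>\<^sub>1\<close> fixes the unitary factor; equality of \<open>\<gamma>\<^sub>2\<close> says that the two exponents of \<open>q\<close>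
  differ by an integer \<open>k\<close>, so \<open>z\<close> and \<open>w\<close> differ by \<open>q\<^sup>k\<close>.\<close>

lemma gamma_separate:
  assumes \<tau>: "Im \<tau> > 0" and z: "z \<noteq> 0" and w: "w \<noteq> 0"
    and eq: "gamma1 \<tau> z = gamma1 \<tau> w" "gamma2 \<tau> z = gamma2 \<tau> w"
  shows "\<exists>n\<in>q_powers (q_pow \<tau> 1). z = n * w"
proof -
  obtain u y where z: "norm u = 1" "z = u * q_pow \<tau> y" using polar_exists[OF \<tau> z] .
  obtain v x where w: "norm v = 1" "w = v * q_pow \<tau> x" using polar_exists[OF \<tau> w] .
  have "exp (2 * \<i> * of_real pi * of_real y) = exp (2 * \<i> * of_real pi * of_real x)"
    using eq(2) unfolding z(2) w(2) gamma_eq[OF \<tau> z(1)] gamma_eq[OF \<tau> w(1)] .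
  then obtain k :: int where "2 * \<i> * of_real pi * complex_of_real y
      = 2 * \<i> * of_real pi * of_real x + of_real (of_int (2 * k) * pi) * \<i>"
    unfolding exp_eq by blast
  then have "2 * \<i> * of_real pi * complex_of_real y = 2 * \<i> * of_real pi * of_real (of_int k + x)"
    by (simp add: algebra_simps)
  then have "complex_of_real y = of_real (of_int k + x)" by simp
  then have "y = of_int k + x" by (simp only: of_real_eq_iff)
  moreover have "u = v" using eq(1) unfolding z(2) w(2) gamma_eq[OF \<tau> z(1)] gamma_eq[OF \<tau> w(1)] .
  ultimately have "z = q_pow \<tau> (of_int k) * w" by (simp add: z w q_pow_add)
  then show ?thesis using q_pow_of_int_mem by blast
qed

lemma power_prod_mem_generate:
  assumes "\<alpha> \<in> carrier (hom_group G Cstar)" "\<beta> \<in> carrier (hom_group G Cstar)"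
  shows "(\<lambda>z\<in>carrier G. \<alpha> z ^ a * \<beta> z ^ b) \<in> generate (hom_group G Cstar) {\<alpha>, \<beta>}"
proof (induction a)
  case 0
  show ?case
  proof (induction b)
    case 0
    have "(\<lambda>z\<in>carrier G. \<alpha> z ^ 0 * \<beta> z ^ 0) = \<one>\<^bsub>hom_group G Cstar\<^esub>"
      by (auto simp: hom_group_def Cstar_def)
    then show ?case by (metis generate.one)
  next
    case (Suc b)
    have "(\<lambda>z\<in>carrier G. \<alpha> z ^ 0 * \<beta> z ^ Suc b)
        = \<beta> \<otimes>\<^bsub>hom_group G Cstar\<^esub> (\<lambda>z\<in>carrier G. \<alpha> z ^ 0 * \<beta> z ^ b)"
      by (auto simp: hom_group_def Cstar_def fun_eq_iff)
    then show ?case by (simp only:) (rule generate.eng[OF generate.incl Suc], simp)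
  qed
next
  case (Suc a)
  have "(\<lambda>z\<in>carrier G. \<alpha> z ^ Suc a * \<beta> z ^ b)
      = \<alpha> \<otimes>\<^bsub>hom_group G Cstar\<^esub> (\<lambda>z\<in>carrier G. \<alpha> z ^ a * \<beta> z ^ b)"
    by (auto simp: hom_group_def Cstar_def fun_eq_iff)
  then show ?case by (simp only:) (rule generate.eng[OF generate.incl Suc], simp)
qed

section \<open>The local Galois group\<close>

lemma annihilator_q_powers:
  assumes "q \<noteq> 0"
  shows "annihilator Cstar Cstar (q_powers q) = {\<gamma> \<in> carrier (hom_group Cstar Cstar). \<gamma> q = 1}"
proof -
  interpret C: comm_group Cstar by (rule comm_group_Cstar)
  have "\<gamma> n = 1" if \<gamma>: "\<gamma> \<in> carrier (hom_group Cstar Cstar)" "\<gamma> q = 1" and n: "n \<in> q_powers q" for \<gamma> n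
  proof -
    interpret \<gamma>: group_hom Cstar Cstar \<gamma>
      using \<gamma> by unfold_locales (simp add: hom_group_def)
    have "generate Cstar {q} \<subseteq> kernel Cstar Cstar \<gamma>"
      by (rule C.generate_subgroup_incl[OF _ \<gamma>.subgroup_kernel])
        (use \<gamma> assms in \<open>auto simp: kernel_def Cstar_def\<close>)
    then show ?thesis using n by (auto simp: kernel_def q_powers_def Cstar_def)
  qed
  moreover have "q \<in> q_powers q" unfolding q_powers_def by (rule generate.incl) simp
  ultimately show ?thesis by (auto simp: annihilator_def) (auto simp: Cstar_def)
qed

text \<open>Only the first factor carries the condition \<open>\<gamma> q = 1\<close>, so subgroups and isomorphisms can be treated
  one factor at a time.\<close>

lemma local_galois_group_eq:
  assumes "q \<noteq> 0"
  shows "local_galois_group q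
    = (hom_group Cstar Cstar \<lparr>carrier := annihilator Cstar Cstar (q_powers q)\<rparr>) \<times>\<times> Gadd"
  unfolding annihilator_q_powers[OF assms] by (auto simp: local_galois_group_def DirProd_def)

lemma normal_q_powers:
  assumes "q \<noteq> 0"
  shows "q_powers q \<lhd> Cstar"
proof -
  interpret C: comm_group Cstar by (rule comm_group_Cstar)
  show ?thesis
    unfolding q_powers_def C.normal_iff_subgroup
    by (rule C.generate_is_subgroup) (use assms in \<open>auto simp: Cstar_def\<close>)
qed

lemma descend_iso:
  assumes q: "q \<noteq> 0"
  shows "descend q \<in> iso (local_galois_group q) (hom_group (Cstar_mod_q q) Cstar \<times>\<times> Gadd)"
proof -
  interpret C: comm_group Cstar by (rule comm_group_Cstar)
  interpret N: normal "q_powers q" Cstar by (rule normal_q_powers[OF q])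
  have grp: "group (hom_group Cstar Cstar \<lparr>carrier := annihilator Cstar Cstar (q_powers q)\<rparr>)"
    by (intro subgroup.subgroup_is_group subgroup_annihilator group_hom_group
        C.is_group comm_group_Cstar N.subset)
  let ?d = "\<lambda>\<gamma>. \<lambda>c\<in>carrier (Cstar Mod q_powers q). the_elem (\<gamma> ` c)"
  have "descend q = (\<lambda>(\<gamma>, l). (?d \<gamma>, id l))"
    by (simp add: descend_def Cstar_mod_q_def fun_eq_iff)
  moreover have "id \<in> iso Gadd Gadd" by (simp add: id_def iso_set_refl)
  ultimately show ?thesis
    unfolding local_galois_group_eq[OF q] Cstar_mod_q_def
    by (simp only: iso_paired2[OF grp group_Gadd] simp_thms
        annihilator_iso_hom_quotient[OF normal_q_powers[OF q] comm_group_Cstar])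
qed

theorem mainTheorem2:
  fixes q \<tau> :: complex
  assumes "norm q > 1"
    and "Im \<tau> > 0"
    and "q = exp (- 2 * \<i> * of_real pi * \<tau>)"
  shows "descend q \<in> iso (local_galois_group q) (hom_group (Cstar_mod_q q) Cstar \<times>\<times> Gadd)
    \<and> subgroup (gamma_Z_subgroup \<tau>) (local_galois_group q)
    \<and> galois_zariski_topology q closure_of gamma_Z_subgroup \<tau> = carrier (local_galois_group q)"
proof (intro conjI)
  interpret C: comm_group Cstar by (rule comm_group_Cstar)
  interpret X: group "hom_group Cstar Cstar" by (rule group_hom_group[OF C.is_group comm_group_Cstar])
  have q: "q = q_pow \<tau> 1" using assms(3) by (simp add: q_pow_def)
  have q0: "q \<noteq> 0" using assms(3) by simp
  interpret N: normal "q_powers q" Cstar by (rule normal_q_powers[OF q0])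
  let ?A = "annihilator Cstar Cstar (q_powers q)"
  let ?G = "carrier (local_galois_group q)"
  let ?D = "generate (hom_group Cstar Cstar) {gamma1 \<tau>, gamma2 \<tau>}"
  show iso: "descend q \<in> iso (local_galois_group q) (hom_group (Cstar_mod_q q) Cstar \<times>\<times> Gadd)"
    by (rule descend_iso[OF q0])
  have A: "subgroup ?A (hom_group Cstar Cstar)"
    by (rule subgroup_annihilator[OF C.is_group comm_group_Cstar N.subset])
  have "exp (2 * \<i> * complex_of_real pi) = 1" using exp_two_pi_i by (simp add: mult_ac)
  then have "gamma1 \<tau> q = 1" "gamma2 \<tau> q = 1"
    using gamma_eq[OF assms(2), of 1 1] by (simp_all add: q)
  then have gamma: "gamma1 \<tau> \<in> ?A" "gamma2 \<tau> \<in> ?A"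
    using gamma_hom[OF assms(2)] by (simp_all add: annihilator_q_powers[OF q0])
  have DA: "?D \<subseteq> ?A" by (rule X.generate_subgroup_incl[OF _ A]) (use gamma in simp)
  have "subgroup ?D (hom_group Cstar Cstar \<lparr>carrier := ?A\<rparr>)"
    by (rule X.subgroup_incl[OF X.generate_is_subgroup A DA]) (use gamma_hom[OF assms(2)] in simp)
  then show sub: "subgroup (gamma_Z_subgroup \<tau>) (local_galois_group q)"
    unfolding local_galois_group_eq[OF q0] gamma_Z_subgroup_def
    by (intro DirProd_subgroups group_Gadd subgroup_Ints subgroup.subgroup_is_group[OF A X.is_group])
  have into: "descend q p \<in> carrier (hom_group (Cstar_mod_q q) Cstar \<times>\<times> Gadd)" if "p \<in> ?G" for p
    using iso that by (auto simp: iso_def hom_def)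
  have M: "monoid (Cstar_mod_q q)"
    unfolding Cstar_mod_q_def using N.factorgroup_is_group by (rule group.is_monoid)
  \<comment> \<open>The functions that \<open>\<gamma>\<^sub>1\<close> and \<open>\<gamma>\<^sub>2\<close> induce on the cosets of \<open>q\<^sup>Z\<close>.\<close>
  define \<alpha> where "\<alpha> = (\<lambda>c. the_elem (gamma1 \<tau> ` c))"
  define \<beta> where "\<beta> = (\<lambda>c. the_elem (gamma2 \<tau> ` c))"
  note val = the_elem_image_coset[OF normal_q_powers[OF q0] C.is_group]
  have sep: "inj_on (\<lambda>c. (\<alpha> c, \<beta> c)) (carrier (Cstar_mod_q q))"
  proof (rule inj_onI)
    fix c d
    assume "c \<in> carrier (Cstar_mod_q q)" "d \<in> carrier (Cstar_mod_q q)"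
    then obtain z w where zw: "z \<in> carrier Cstar" "c = q_powers q #>\<^bsub>Cstar\<^esub> z"
      "w \<in> carrier Cstar" "d = q_powers q #>\<^bsub>Cstar\<^esub> w"
      by (auto simp: Cstar_mod_q_def carrier_FactGroup)
    assume "(\<alpha> c, \<beta> c) = (\<alpha> d, \<beta> d)"
    then have "gamma1 \<tau> z = gamma1 \<tau> w" "gamma2 \<tau> z = gamma2 \<tau> w"
      using zw gamma by (simp_all add: \<alpha>_def \<beta>_def val)
    then obtain n where "n \<in> q_powers q" "z = n * w"
      using gamma_separate[OF assms(2), of z w] zw by (auto simp: Cstar_def q)
    then have "z \<in> q_powers q #>\<^bsub>Cstar\<^esub> w" by (auto simp: r_coset_def Cstar_def)
    then show "c = d" using C.repr_independence[OF _ zw(3) N.subgroup_axioms] zw by simp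
  qed
  have dense: "\<exists>s\<in>gamma_Z_subgroup \<tau>. eval_at f (descend q s) \<noteq> 0"
    if f: "f \<in> coordinate_ring (Cstar_mod_q q)" and d: "f d \<noteq> 0" for f d
  proof (rule ccontr)
    assume none: "\<not> ?thesis"
    have "eval_at f (\<lambda>c\<in>carrier (Cstar_mod_q q). \<alpha> c ^ a * \<beta> c ^ b, of_nat n) = 0" for a b n
    proof -
      define \<eta> where "\<eta> = (\<lambda>z\<in>carrier Cstar. gamma1 \<tau> z ^ a * gamma2 \<tau> z ^ b)"
      have \<eta>: "\<eta> \<in> ?D"
        unfolding \<eta>_def by (rule power_prod_mem_generate) (rule gamma_hom[OF assms(2)])+
      then have \<eta>A: "\<eta> \<in> ?A" using DA by blast
      have \<eta>_eq: "\<eta> z = gamma1 \<tau> z ^ a * gamma2 \<tau> z ^ b" if "z \<in> carrier Cstar" for z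
        using that by (simp add: \<eta>_def)
      have "descend q (\<eta>, of_nat n)
          = (\<lambda>c\<in>carrier (Cstar_mod_q q). \<alpha> c ^ a * \<beta> c ^ b, of_nat n)"
        using gamma \<eta>A by (auto simp: descend_def Cstar_mod_q_def carrier_FactGroup val \<alpha>_def \<beta>_def
            \<eta>_eq intro!: restrict_ext)
      moreover have "(\<eta>, of_nat n) \<in> gamma_Z_subgroup \<tau>"
        using \<eta> by (simp add: gamma_Z_subgroup_def)
      ultimately show ?thesis using none by metis
    qed
    from vanishing_on_powers_imp_0[OF f sep this] d show False by simp
  qed
  have top: "topspace (galois_zariski_topology q) = ?G"
    unfolding galois_zariski_topology_def topspace_pullback_topology topspace_zariski[OF M]
    using into by auto
  have "\<exists>s. s \<in> gamma_Z_subgroup \<tau> \<and> s \<in> T"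
    if pT: "p \<in> T" and T: "openin (galois_zariski_topology q) T" for p T
  proof -
    obtain F where F: "F \<subseteq> coordinate_ring (Cstar_mod_q q)"
      "T = descend q -` (carrier (hom_group (Cstar_mod_q q) Cstar \<times>\<times> Gadd)
             - zero_locus (Cstar_mod_q q) F) \<inter> ?G"
      using T unfolding galois_zariski_topology_def openin_pullback_topology openin_zariski[OF M] by blast
    then obtain f where f: "f \<in> F" "eval_at f (descend q p) \<noteq> 0"
      using pT by (auto simp: zero_locus_def)
    have "\<exists>d. f d \<noteq> 0"
    proof (rule ccontr)
      assume "\<not> ?thesis"
      then have "eval_at f (descend q p) = 0" by (simp add: eval_at_def split: prod.split)
      with f(2) show False by simp
    qed
    then obtain s where s: "s \<in> gamma_Z_subgroup \<tau>" "eval_at f (descend q s) \<noteq> 0"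
      using dense f(1) F(1) by blast
    moreover have "s \<in> ?G" using s(1) subgroup.subset[OF sub] by blast
    ultimately have "s \<in> T" using f(1) into unfolding F(2) by (auto simp: zero_locus_def)
    then show ?thesis using s(1) by blast
  qed
  then show "galois_zariski_topology q closure_of gamma_Z_subgroup \<tau> = ?G"
    unfolding closure_of_def top by blast
qed

end
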